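(* Consider the crowdsourcing scheduling problem and the DIS algorithm described in the context. For every $\epsilon>0$, the DIS algorithm run with parameter $\eta=\epsilon$ is a deterministic algorithm whose schedule has total weighted completion time at most $\max\{2.5,1+\epsilon\}$ times the minimum total weighted completion time.
   Context: Problem: $m$ crowd workers $u_1,\dots,u_m$ with rates $\lambda_j>0$, and tasks $\mathcal{S}=\{s_1,\dots,s_n\}$ with required service times $\tau_i>0$ and weights $w_i>0$. Let $e_j=\frac{2}{\lambda_j}$. Each task is assigned to one worker; each worker processes its tasks sequentially; a task $s_i$ on $u_j$ has completion time $C_i=e_j+\sum\tau_k$, summing over tasks on $u_j$ processed no later than $s_i$ (including $s_i$). Objective: minimize $\sum_i w_iC_i$. Intervals: for $\eta>0$ let $L=\lceil\log_{1+\eta}(\sum_i\tau_i)\rceil$, $\mathcal{L}=\{0,\dots,L\}$, $I_0=[0,1]$, $I_\ell=((1+\eta)^{\ell-1},(1+\eta)^\ell]$ for $1\le\ell\le L$, $|I_0|=1$, $|I_\ell|=\eta(1+\eta)^{\ell-1}$ for $\ell\ge1$. Linear program: minimize $\sum_i w_iC_i$ over $y_{ij\ell}\ge0$ and $C_i$ subject to: $\sum_j\sum_\ell\frac{y_{ij\ell}|I_\ell|}{\tau_i}=1$ for all $i$; $\sum_i y_{ij\ell}\le1$ for all $j,\ell$; $C_i=\sum_j\sum_\ell\left(\frac{y_{ij\ell}|I_\ell|}{\tau_i}\left(e_j+(1+\eta)^{\ell-1}\right)+\frac12 y_{ij\ell}|I_\ell|\right)$ (with $(1+\eta)^{\ell-1}$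 read as $\frac12$ when $\ell=0$); $C_i\ge\sum_j\sum_\ell y_{ij\ell}|I_\ell|$. Conditional expectation: for a set $\mathcal{P}$ of tasks fixed to worker-interval pairs (recorded by $x$), let every task outside $\mathcal{P}$ be independently assigned to $(j,\ell)$ with probability $\frac{y_{ij\ell}|I_\ell|}{\tau_i}$; a task at $(j,\ell)$ goes to $u_j$ with $t_i$ the left endpoint of $I_\ell$; each worker processes its tasks as early as possible in non-decreasing $t_i$, ties broken by smaller index. $E_{\mathcal{P},x}[\sum_q w_qC_q]$ is the resulting expected objective. DIS algorithm: compute an optimal LP solution $y$; start with $\mathcal{P}=\emptyset$; for each task $s_i$ in turn, choose the worker-interval pair $(j,\ell)$ minimizing $E_{\mathcal{P}\cup\{s_i\},x}[\sum_q w_qC_q]$ when $s_i$ is fixed to $(j,\ell)$, fix $s_i$ there (set $t_i$ to the left endpoint of $I_\ell$, put $s_i$ in $\mathcal{S}_j$) and add it to $\mathcal{P}$; finally schedule each worker's tasks as early as possible in non-decreasing order of $t_i$, ties broken by smaller index.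
   Formalization: All service times τ_i are assumed at least 1 (for merely positive τ_i the ratio can be arbitrarily large), and the linear program is assumed to have an optimal solution (as written it can be infeasible, and DIS is then undefined). *)

theory Defs
  imports "HOL-Probability.Probability"
begin

text \<open>
  Workers are the numbers below \<open>workers I\<close>, tasks the numbers below \<open>tasks I\<close>; the values of
  \<open>rate\<close>, \<open>service\<close> and \<open>weight\<close> outside these ranges are irrelevant.
\<close>

record crowd =
  workers :: nat
  tasks :: nat
  rate :: "nat \<Rightarrow> real"
  service :: "nat \<Rightarrow> real"
  weight :: "nat \<Rightarrow> real"

definition crowd_instance :: "crowd \<Rightarrow> bool" where
  "crowd_instance I \<longleftrightarrow>
     0 < workers I \<and> 0 < tasks I \<and>
     (\<forall>j<workers I. 0 < rate I j) \<and>
     (\<forall>i<tasks I. 0 < service I i \<and> 0 < weight I i)"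

definition delay :: "crowd \<Rightarrow> nat \<Rightarrow> real" where
  "delay I j = 2 / rate I j"

text \<open>
  A schedule is an assignment of tasks to workers together with a linear order on all tasks;
  a pair \<open>(k, i)\<close> of tasks of the same worker belongs to the order iff \<open>k\<close> is processed no later
  than \<open>i\<close>. Every family of processing sequences, one for each worker, is induced by such an
  order; how it compares tasks of different workers has no effect on the completion times.
\<close>

type_synonym schedule = "(nat \<Rightarrow> nat) \<times> (nat \<times> nat) set"

definition schedules :: "crowd \<Rightarrow> schedule set" where
  "schedules I = {(a, r). a \<in> {..<tasks I} \<rightarrow>\<^sub>E {..<workers I} \<and> linear_order_on {..<tasks I} r}"

definition completion :: "crowd \<Rightarrow> schedule \<Rightarrow> nat \<Rightarrow> real" where
  "completion I S i =
     delay I (fst S i) +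
     (\<Sum>k | k < tasks I \<and> fst S k = fst S i \<and> (k, i) \<in> snd S. service I k)"

definition total_cost :: "crowd \<Rightarrow> schedule \<Rightarrow> real" where
  "total_cost I S = (\<Sum>i<tasks I. weight I i * completion I S i)"

definition min_cost :: "crowd \<Rightarrow> real" where
  "min_cost I = Min (total_cost I ` schedules I)"

lemma finite_schedules: "finite (schedules I)"
proof (rule finite_subset)
  show "schedules I \<subseteq>
      ({..<tasks I} \<rightarrow>\<^sub>E {..<workers I}) \<times> Pow ({..<tasks I} \<times> {..<tasks I})"
    by (auto simp: schedules_def linear_order_on_def partial_order_on_def preorder_on_def)
  show "finite (({..<tasks I} \<rightarrow>\<^sub>E {..<workers I}) \<times> Pow ({..<tasks I} \<times> {..<tasks I}))"
    by (intro finite_cartesian_product finite_PiE) auto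
qed

lemma schedules_nonempty:
  assumes "crowd_instance I"
  shows "schedules I \<noteq> {}"
proof -
  have "(restrict (\<lambda>_. 0) {..<tasks I}, {(k, i). k < tasks I \<and> i < tasks I \<and> k \<le> i}) \<in> schedules I"
    using assms
    by (auto simp: schedules_def crowd_instance_def linear_order_on_def partial_order_on_def
        preorder_on_def refl_on_def trans_def antisym_def total_on_def)
  then show ?thesis by blast
qed

text \<open>
  Interval \<open>0\<close> is \<open>[0, 1]\<close>, and interval \<open>l \<ge> 1\<close> is \<open>((1 + \<eta>) ^ (l - 1), (1 + \<eta>) ^ l]\<close>.
  The intervals in use are those with \<open>l \<le> top_interval \<eta> I\<close>. The interval \<open>[0, 1]\<close> presupposes a
  time unit in which every service time is at least \<open>1\<close>: tasks that all fit into \<open>[0, 1]\<close> would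
  be processed in index order, whatever their weights. Under that normalization the ceiling in
  \<open>top_interval\<close> is nonnegative.
\<close>

definition top_interval :: "real \<Rightarrow> crowd \<Rightarrow> nat" where
  "top_interval \<eta> I = nat \<lceil>log (1 + \<eta>) (\<Sum>i<tasks I. service I i)\<rceil>"

definition interval_length :: "real \<Rightarrow> nat \<Rightarrow> real" where
  "interval_length \<eta> l = (if l = 0 then 1 else \<eta> * (1 + \<eta>) ^ (l - 1))"

definition left_endpoint :: "real \<Rightarrow> nat \<Rightarrow> real" where
  "left_endpoint \<eta> l = (if l = 0 then 0 else (1 + \<eta>) ^ (l - 1))"

text \<open>The quantity written \<open>(1 + \<eta>) ^ (l - 1)\<close> in the linear program, which is read as \<open>1/2\<close> for
  \<open>l = 0\<close> although the left endpoint is then \<open>0\<close>.\<close>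

definition lp_start :: "real \<Rightarrow> nat \<Rightarrow> real" where
  "lp_start \<eta> l = (if l = 0 then 1 / 2 else (1 + \<eta>) ^ (l - 1))"

type_synonym lp_vars = "nat \<Rightarrow> nat \<Rightarrow> nat \<Rightarrow> real"

text \<open>Because \<open>C i\<close> is prescribed by an equation, its lower bound restricts \<open>y\<close>, and the program
  can be infeasible.\<close>

definition lp_feasible :: "real \<Rightarrow> crowd \<Rightarrow> lp_vars \<Rightarrow> (nat \<Rightarrow> real) \<Rightarrow> bool" where
  "lp_feasible \<eta> I y C \<longleftrightarrow>
     (\<forall>i<tasks I. \<forall>j<workers I. \<forall>l\<le>top_interval \<eta> I. 0 \<le> y i j l) \<and>
     (\<forall>i<tasks I.
        (\<Sum>j<workers I. \<Sum>l\<le>top_interval \<eta> I. y i j l * interval_length \<eta> l / service I i) = 1) \<and>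
     (\<forall>j<workers I. \<forall>l\<le>top_interval \<eta> I. (\<Sum>i<tasks I. y i j l) \<le> 1) \<and>
     (\<forall>i<tasks I. C i =
        (\<Sum>j<workers I. \<Sum>l\<le>top_interval \<eta> I.
           y i j l * interval_length \<eta> l / service I i * (delay I j + lp_start \<eta> l)
           + 1 / 2 * y i j l * interval_length \<eta> l)) \<and>
     (\<forall>i<tasks I. C i \<ge>
        (\<Sum>j<workers I. \<Sum>l\<le>top_interval \<eta> I. y i j l * interval_length \<eta> l))"

definition lp_objective :: "crowd \<Rightarrow> (nat \<Rightarrow> real) \<Rightarrow> real" where
  "lp_objective I C = (\<Sum>i<tasks I. weight I i * C i)"

definition lp_optimal :: "real \<Rightarrow> crowd \<Rightarrow> lp_vars \<Rightarrow> (nat \<Rightarrow> real) \<Rightarrow> bool" where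
  "lp_optimal \<eta> I y C \<longleftrightarrow>
     lp_feasible \<eta> I y C \<and>
     (\<forall>y' C'. lp_feasible \<eta> I y' C' \<longrightarrow> lp_objective I C \<le> lp_objective I C')"

definition worker_intervals :: "real \<Rightarrow> crowd \<Rightarrow> (nat \<times> nat) set" where
  "worker_intervals \<eta> I = {..<workers I} \<times> {..top_interval \<eta> I}"

text \<open>The density below is a probability mass function whenever \<open>y\<close> is feasible for the linear
  program and \<open>i\<close> is a task.\<close>

definition task_pmf :: "real \<Rightarrow> crowd \<Rightarrow> lp_vars \<Rightarrow> nat \<Rightarrow> (nat \<times> nat) pmf" where
  "task_pmf \<eta> I y i = embed_pmf (\<lambda>(j, l).
     if (j, l) \<in> worker_intervals \<eta> I then y i j l * interval_length \<eta> l / service I i else 0)"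

text \<open>The schedule in which each task \<open>i\<close> goes to worker \<open>fst (x i)\<close> and each worker processes its
  tasks by non-decreasing left endpoint of the interval \<open>snd (x i)\<close>, ties broken by smaller index.\<close>

definition induced_schedule :: "real \<Rightarrow> crowd \<Rightarrow> (nat \<Rightarrow> nat \<times> nat) \<Rightarrow> schedule" where
  "induced_schedule \<eta> I x =
     (restrict (\<lambda>i. fst (x i)) {..<tasks I},
      {(k, i). k < tasks I \<and> i < tasks I \<and>
         (left_endpoint \<eta> (snd (x k)) < left_endpoint \<eta> (snd (x i)) \<or>
          left_endpoint \<eta> (snd (x k)) = left_endpoint \<eta> (snd (x i)) \<and> k \<le> i)})"

text \<open>Expected cost when the tasks in \<open>P\<close> are fixed to the pairs recorded by \<open>x\<close> and the others are
  drawn independently.\<close>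

definition cond_exp_cost ::
    "real \<Rightarrow> crowd \<Rightarrow> lp_vars \<Rightarrow> nat set \<Rightarrow> (nat \<Rightarrow> nat \<times> nat) \<Rightarrow> real" where
  "cond_exp_cost \<eta> I y P x =
     measure_pmf.expectation
       (Pi_pmf {..<tasks I} undefined (\<lambda>i. if i \<in> P then return_pmf (x i) else task_pmf \<eta> I y i))
       (\<lambda>z. total_cost I (induced_schedule \<eta> I z))"

text \<open>
  The pairs fixed after the first \<open>i\<close> tasks. The function \<open>tie\<close> is the rule selecting one pair
  among those attaining the minimum; it may depend on the task considered.
\<close>

primrec dis_fix :: "real \<Rightarrow> crowd \<Rightarrow> lp_vars \<Rightarrow> (nat \<Rightarrow> (nat \<times> nat) set \<Rightarrow> nat \<times> nat) \<Rightarrow> nat \<Rightarrow>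
    nat \<Rightarrow> nat \<times> nat" where
  "dis_fix \<eta> I y tie 0 = (\<lambda>_. undefined)"
| "dis_fix \<eta> I y tie (Suc i) =
     (let x = dis_fix \<eta> I y tie i;
          E = (\<lambda>p. cond_exp_cost \<eta> I y (insert i {..<i}) (x(i := p)))
      in x(i := tie i {p \<in> worker_intervals \<eta> I. \<forall>q\<in>worker_intervals \<eta> I. E p \<le> E q}))"

definition dis_schedule ::
    "real \<Rightarrow> crowd \<Rightarrow> lp_vars \<Rightarrow> (nat \<Rightarrow> (nat \<times> nat) set \<Rightarrow> nat \<times> nat) \<Rightarrow> schedule" where
  "dis_schedule \<eta> I y tie = induced_schedule \<eta> I (dis_fix \<eta> I y tie (tasks I))"

end

theory Submission
  imports Defs
begin

text \<open>
  Assigning every task independently with the probabilities of the linear program gives an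
  expected completion time of at most \<open>max 2 (1 + \<eta>)\<close> times \<open>C i\<close>: the tasks placed no later than
  interval \<open>l\<close> of a worker take at most \<open>(1 + \<eta>) ^ l \<le> max 2 (1 + \<eta>) * lp_start \<eta> l\<close> in expectation,
  and the task's own service time enters \<open>C i\<close> with factor \<open>1/2\<close>. Fixing the tasks one by one
  to a best pair never increases the conditional expectation.

  The program is a relaxation although it also demands that \<open>C i\<close> is at least the service time of
  task \<open>i\<close>. Cutting a schedule at the interval endpoints gives amounts with low enough values
  \<open>C i\<close> that may violate this demand; by an exchange argument in the transportation polytope, if
  the program is feasible at all, some solution satisfies the demand without exceeding any
  completion time of the schedule.
\<close>

subsection \<open>Transportation plans\<close>

definition transport_plan ::
    "'a set \<Rightarrow> 'b set \<Rightarrow> ('a \<Rightarrow> real) \<Rightarrow> ('b \<Rightarrow> real) \<Rightarrow> ('a \<times> 'b \<Rightarrow> real) \<Rightarrow> bool" where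
  "transport_plan N Q s cap x \<longleftrightarrow>
     (\<forall>i\<in>N. \<forall>p\<in>Q. 0 \<le> x (i, p)) \<and>
     (\<forall>i\<in>N. (\<Sum>p\<in>Q. x (i, p)) = s i) \<and>
     (\<forall>p\<in>Q. (\<Sum>i\<in>N. x (i, p)) \<le> cap p)"

definition plan_value :: "'b set \<Rightarrow> ('b \<Rightarrow> real) \<Rightarrow> ('a \<times> 'b \<Rightarrow> real) \<Rightarrow> 'a \<Rightarrow> real" where
  "plan_value Q v x i = (\<Sum>p\<in>Q. x (i, p) * v p)"

lemma transport_plan_le_cap:
  assumes "finite N" "transport_plan N Q s cap x" "i \<in> N" "p \<in> Q"
  shows "x (i, p) \<le> cap p"
proof -
  have "x (i, p) \<le> (\<Sum>i\<in>N. x (i, p))"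
    using assms by (intro member_le_sum) (auto simp: transport_plan_def)
  then show ?thesis using assms by (auto simp: transport_plan_def intro: order_trans)
qed

text \<open>Compactness: relevant plans lie in a product of compact intervals, all conditions on
  them are closed, and the sum of squares is continuous.\<close>

lemma plan_minimizer:
  fixes cap v :: "'b \<Rightarrow> real" and s d b :: "'a \<Rightarrow> real"
  assumes fin: "finite N" "finite Q"
    and x1: "transport_plan N Q s cap x1" "\<And>i. i \<in> N \<Longrightarrow> d i \<le> plan_value Q v x1 i"
  obtains x where "transport_plan N Q s cap x" "\<And>i. i \<in> N \<Longrightarrow> d i \<le> plan_value Q v x i"
    and "\<And>x'. transport_plan N Q s cap x' \<Longrightarrow> (\<And>i. i \<in> N \<Longrightarrow> d i \<le> plan_value Q v x' i) \<Longrightarrow>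
      (\<Sum>i\<in>N. (plan_value Q v x i - b i)\<^sup>2) \<le> (\<Sum>i\<in>N. (plan_value Q v x' i - b i)\<^sup>2)"
proof -
  \<comment> \<open>Coordinates outside \<open>N \<times> Q\<close>, on which a plan is
    unconstrained, are pinned to 0, so the product is compact whatever the index type.\<close>
  define B where "B = PiE UNIV (\<lambda>ip. if fst ip \<in> N \<and> snd ip \<in> Q then {0..cap (snd ip)} else {0::real})"
  define K where "K = {x \<in> B. transport_plan N Q s cap x \<and> (\<forall>i\<in>N. d i \<le> plan_value Q v x i)}"
  have coord: "continuous_on UNIV (\<lambda>x::'a \<times> 'b \<Rightarrow> real. x ip)" for ip
    by (rule continuous_on_product_coordinates)
  have "compact B"
    unfolding B_def compactin_euclidean_iff[symmetric] euclidean_product_topology[symmetric]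
    by (subst compactin_PiE) auto
  moreover have "closed {x. transport_plan N Q s cap x \<and> (\<forall>i\<in>N. d i \<le> plan_value Q v x i)}"
    unfolding transport_plan_def plan_value_def Ball_def
    by (intro closed_Collect_conj closed_Collect_all closed_Collect_imp open_Collect_const
        closed_Collect_le closed_Collect_eq continuous_intros coord)
  ultimately have "compact (B \<inter> {x. transport_plan N Q s cap x \<and> (\<forall>i\<in>N. d i \<le> plan_value Q v x i)})"
    by (rule compact_Int_closed)
  also have "\<dots> = K" by (auto simp only: K_def)
  finally have "compact K" .
  \<comment> \<open>Clearing the unconstrained coordinates turns any competitor into a member of
    \<open>K\<close> with the same values.\<close>
  define cut where "cut x = (\<lambda>ip. if fst ip \<in> N \<and> snd ip \<in> Q then x ip else 0 :: real)" for x
  have cut_plan: "transport_plan N Q s cap (cut x) = transport_plan N Q s cap x" for x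
    unfolding transport_plan_def cut_def by (simp cong: sum.cong)
  have cut_value: "plan_value Q v (cut x) i = plan_value Q v x i" if "i \<in> N" for x i
    using that unfolding plan_value_def cut_def by (simp cong: sum.cong)
  have cut_K: "cut x \<in> K" if "transport_plan N Q s cap x" "\<And>i. i \<in> N \<Longrightarrow> d i \<le> plan_value Q v x i" for x
    using that transport_plan_le_cap[OF fin(1) that(1)]
    by (auto simp: K_def B_def cut_plan cut_value) (auto simp: cut_def transport_plan_def)
  have "continuous_on K (\<lambda>x. \<Sum>i\<in>N. (plan_value Q v x i - b i)\<^sup>2)"
    unfolding plan_value_def
    by (intro continuous_intros continuous_on_subset[OF coord]) auto
  moreover have "K \<noteq> {}" using cut_K[OF x1] by auto
  ultimately obtain x where x: "x \<in> K" and
    min: "\<forall>x'\<in>K. (\<Sum>i\<in>N. (plan_value Q v x i - b i)\<^sup>2) \<le> (\<Sum>i\<in>N. (plan_value Q v x' i - b i)\<^sup>2)"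
    using continuous_attains_inf[OF \<open>compact K\<close>] by blast
  show thesis
  proof (rule that[of x])
    fix x' assume "transport_plan N Q s cap x'" "\<And>i. i \<in> N \<Longrightarrow> d i \<le> plan_value Q v x' i"
    then have "cut x' \<in> K" by (rule cut_K)
    then have "(\<Sum>i\<in>N. (plan_value Q v x i - b i)\<^sup>2) \<le> (\<Sum>i\<in>N. (plan_value Q v (cut x') i - b i)\<^sup>2)"
      using min by blast
    also have "\<dots> = (\<Sum>i\<in>N. (plan_value Q v x' i - b i)\<^sup>2)" by (simp add: cut_value cong: sum.cong)
    finally show "(\<Sum>i\<in>N. (plan_value Q v x i - b i)\<^sup>2) \<le> \<dots>" .
  qed (use x in \<open>auto simp: K_def\<close>)
qed

text \<open>Signed amounts \<open>g\<close> let one construction serve twice: for moving part of a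
  single task into free capacity, and for swapping equal amounts of two tasks between
  \<open>p\<close> and \<open>q\<close>.\<close>

definition shift :: "('a \<Rightarrow> real) \<Rightarrow> 'b \<Rightarrow> 'b \<Rightarrow> ('a \<times> 'b \<Rightarrow> real) \<Rightarrow> 'a \<times> 'b \<Rightarrow> real" where
  "shift g p q x = (\<lambda>(i, r). x (i, r) + g i * (of_bool (r = q) - of_bool (r = p)))"

text \<open>The weight \<open>f\<close> is left free: the constant 1 shows that demands stay met,
  and \<open>v\<close> gives the change of the plan value.\<close>

lemma shift_row:
  fixes f :: "'b \<Rightarrow> real"
  assumes "finite Q" "p \<in> Q" "q \<in> Q"
  shows "(\<Sum>r\<in>Q. shift g p q x (i, r) * f r) = (\<Sum>r\<in>Q. x (i, r) * f r) + g i * (f q - f p)"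
proof -
  have "(\<Sum>r\<in>Q. shift g p q x (i, r) * f r) =
      (\<Sum>r\<in>Q. x (i, r) * f r + g i * (if r = q then f r else 0) - g i * (if r = p then f r else 0))"
    by (intro sum.cong) (auto simp: shift_def algebra_simps)
  then show ?thesis
    using assms by (simp add: sum.distrib sum_subtractf flip: sum_distrib_left) (simp add: algebra_simps)
qed

lemma plan_value_shift:
  assumes "finite Q" "p \<in> Q" "q \<in> Q"
  shows "plan_value Q v (shift g p q x) i = plan_value Q v x i - g i * (v p - v q)"
  using shift_row[OF assms] by (simp add: plan_value_def algebra_simps)

text \<open>Only the columns \<open>p\<close> and \<open>q\<close> change. The first loses the
  nonnegative amount \<open>sum g N\<close> and the second gains it, so capacity is at risk at
  \<open>q\<close> alone.\<close>

lemma transport_plan_shift: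
  assumes fin: "finite N" "finite Q" and pq: "p \<in> Q" "q \<in> Q" "p \<noteq> q"
    and x: "transport_plan N Q s cap x"
    and pos: "\<And>i. i \<in> N \<Longrightarrow> g i \<le> x (i, p)" "\<And>i. i \<in> N \<Longrightarrow> - g i \<le> x (i, q)"
    and g0: "0 \<le> sum g N"
    and cap: "(\<Sum>i\<in>N. x (i, q)) + sum g N \<le> cap q"
  shows "transport_plan N Q s cap (shift g p q x)"
proof -
  have "(\<Sum>r\<in>Q. shift g p q x (i, r)) = (\<Sum>r\<in>Q. x (i, r))" for i
    using shift_row[OF fin(2) pq(1,2), of g x i "\<lambda>_. 1"] by simp
  moreover have "(\<Sum>i\<in>N. shift g p q x (i, r)) \<le> cap r" if "r \<in> Q" for r
  proof -
    have "(\<Sum>i\<in>N. shift g p q x (i, r)) = (\<Sum>i\<in>N. x (i, r)) + sum g N * (of_bool (r = q) - of_bool (r = p))"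
      unfolding shift_def by (simp add: sum.distrib sum_distrib_right)
    moreover have "(\<Sum>i\<in>N. x (i, r)) \<le> cap r" using x that by (auto simp: transport_plan_def)
    ultimately show ?thesis using g0 cap pq by (auto simp: of_bool_def)
  qed
  moreover have "0 \<le> shift g p q x (i, r)" if "i \<in> N" "r \<in> Q" for i r
    using pos[OF that(1)] x that pq by (auto simp: shift_def transport_plan_def)
  ultimately show ?thesis
    using x by (simp add: transport_plan_def)
qed

text \<open>A plan minimizing the sum of squared deviations from \<open>b\<close> works. Whenever a task whose value
  exceeds its bound uses a place, all cheaper places are full and used only by such tasks, as
  otherwise a small shift or swap would decrease the sum. Hence these tasks use the cheapest
  capacity available and have the least possible total value, which \<open>x0\<close> cannot undercut.\<close>

lemma transport_exchange:
  fixes cap v :: "'b \<Rightarrow> real" and s d b :: "'a \<Rightarrow> real"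
  assumes fin: "finite N" "finite Q"
    and s: "\<And>i. i \<in> N \<Longrightarrow> 0 < s i"
    and db: "\<And>i. i \<in> N \<Longrightarrow> d i \<le> b i"
    and x0: "transport_plan N Q s cap x0" "\<And>i. i \<in> N \<Longrightarrow> plan_value Q v x0 i \<le> b i"
    and x1: "transport_plan N Q s cap x1" "\<And>i. i \<in> N \<Longrightarrow> d i \<le> plan_value Q v x1 i"
  obtains x where "transport_plan N Q s cap x"
    and "\<And>i. i \<in> N \<Longrightarrow> d i \<le> plan_value Q v x i" "\<And>i. i \<in> N \<Longrightarrow> plan_value Q v x i \<le> b i"
proof -
  from plan_minimizer[OF fin x1, where b = b] obtain x where
    x: "transport_plan N Q s cap x" and dx: "\<And>i. i \<in> N \<Longrightarrow> d i \<le> plan_value Q v x i"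
    and min: "\<And>x'. transport_plan N Q s cap x' \<Longrightarrow> (\<And>i. i \<in> N \<Longrightarrow> d i \<le> plan_value Q v x' i) \<Longrightarrow>
      (\<Sum>i\<in>N. (plan_value Q v x i - b i)\<^sup>2) \<le> (\<Sum>i\<in>N. (plan_value Q v x' i - b i)\<^sup>2)"
    by blast
  define a where "a = plan_value Q v x"
  define R where "R = {i \<in> N. b i < a i}"
  have finR: "finite R" and RN: "R \<subseteq> N" using fin by (auto simp: R_def)
  have x_nn: "0 \<le> x (i, p)" "0 \<le> x0 (i, p)" if "i \<in> N" "p \<in> Q" for i p
    using x x0(1) that by (auto simp: transport_plan_def)
  have no_shift: "(\<Sum>i\<in>N. (a i - b i)\<^sup>2) \<le> (\<Sum>i\<in>N. (a i - g i * (v p - v q) - b i)\<^sup>2)"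
    if "p \<in> Q" "q \<in> Q" "p \<noteq> q" "\<And>i. i \<in> N \<Longrightarrow> g i \<le> x (i, p)" "\<And>i. i \<in> N \<Longrightarrow> - g i \<le> x (i, q)"
      "0 \<le> sum g N" "(\<Sum>i\<in>N. x (i, q)) + sum g N \<le> cap q"
      "\<And>i. i \<in> N \<Longrightarrow> d i \<le> a i - g i * (v p - v q)" for g p q
    using min[OF transport_plan_shift[OF fin that(1-3) x that(4-7)]] that(8)
    by (simp add: plan_value_shift[OF fin(2) that(1,2)] a_def)
  have full: "(\<Sum>i\<in>N. x (i, q)) = cap q"
    if i: "i \<in> R" and pq: "p \<in> Q" "q \<in> Q" and xp: "0 < x (i, p)" and vv: "v q < v p" for i p q
  proof (rule ccontr)
    assume "(\<Sum>i\<in>N. x (i, q)) \<noteq> cap q"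
    then have slack: "0 < cap q - (\<Sum>i\<in>N. x (i, q))"
      using x pq by (auto simp: transport_plan_def order.order_iff_strict)
    \<comment> \<open>The three bounds keep \<open>q\<close> within capacity, take no more than task
      \<open>i\<close> has at \<open>p\<close>, and keep the value of \<open>i\<close> from falling
      below \<open>b i\<close>, hence also below \<open>d i\<close>.\<close>
    define z where "z = Min {cap q - (\<Sum>i\<in>N. x (i, q)), x (i, p), (a i - b i) / (v p - v q)}"
    have iN: "i \<in> N" and ai: "b i < a i" using i by (auto simp: R_def)
    have z: "0 < z" "z \<le> cap q - (\<Sum>i\<in>N. x (i, q))" "z \<le> x (i, p)" "z \<le> (a i - b i) / (v p - v q)"
      using slack xp vv ai by (auto simp: z_def)
    define \<gamma> where "\<gamma> = z * (v p - v q)"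
    have \<gamma>: "0 < \<gamma>" "\<gamma> \<le> a i - b i" using z vv by (auto simp: \<gamma>_def field_simps)
    define g where "g k = (if k = i then z else 0)" for k
    have sg: "sum g N = z" using iN fin by (simp add: g_def)
    have "(\<Sum>k\<in>N. (a k - b k)\<^sup>2) \<le> (\<Sum>k\<in>N. (a k - g k * (v p - v q) - b k)\<^sup>2)"
    proof (rule no_shift)
      show "d k \<le> a k - g k * (v p - v q)" if "k \<in> N" for k
        using that dx[OF that] db[OF that] \<gamma> by (auto simp: g_def a_def \<gamma>_def)
    qed (use pq vv z x_nn x_nn(1)[OF iN pq(2)] sg in \<open>auto simp: g_def\<close>)
    also have "\<dots> < (\<Sum>k\<in>N. (a k - b k)\<^sup>2)"
    proof (rule sum_strict_mono_ex1[OF fin(1)])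
      have "(a i - \<gamma> - b i)\<^sup>2 < (a i - b i)\<^sup>2"
        using \<gamma> by (intro power_strict_mono) auto
      then show "\<exists>k\<in>N. (a k - g k * (v p - v q) - b k)\<^sup>2 < (a k - b k)\<^sup>2"
        using iN by (auto simp: g_def \<gamma>_def intro!: bexI[of _ i])
      with \<open>(a i - \<gamma> - b i)\<^sup>2 < (a i - b i)\<^sup>2\<close>
      show "\<forall>k\<in>N. (a k - g k * (v p - v q) - b k)\<^sup>2 \<le> (a k - b k)\<^sup>2"
        by (auto simp: g_def \<gamma>_def)
    qed
    finally show False by simp
  qed
  have closed: "k \<in> R"
    if i: "i \<in> R" and pq: "p \<in> Q" "q \<in> Q" and xp: "0 < x (i, p)" and vv: "v q < v p"
      and k: "k \<in> N" "0 < x (k, q)" for i p q k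
  proof (rule ccontr)
    assume "k \<notin> R"
    then have ak: "a k \<le> b k" and ik: "i \<noteq> k" using k i by (auto simp: R_def)
    \<comment> \<open>The swap raises the value of \<open>k\<close> by as much as it lowers that of
      \<open>i\<close>. The factor 2 makes \<gamma> strictly smaller than \<open>a i - b i\<close>,
      which with \<open>a k \<le> b k\<close> makes the change of the sum of squares
      negative.\<close>
    define z where "z = Min {x (k, q), x (i, p), (a i - b i) / (2 * (v p - v q))}"
    have iN: "i \<in> N" and ai: "b i < a i" using i by (auto simp: R_def)
    have z: "0 < z" "z \<le> x (k, q)" "z \<le> x (i, p)" "z \<le> (a i - b i) / (2 * (v p - v q))"
      using k xp vv ai by (auto simp: z_def)
    define \<gamma> where "\<gamma> = z * (v p - v q)"
    have \<gamma>: "0 < \<gamma>" "2 * \<gamma> \<le> a i - b i" using z vv by (auto simp: \<gamma>_def field_simps)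
    \<comment> \<open>These amounts cancel, so the swap needs no free capacity at
      \<open>q\<close>.\<close>
    define g where "g l = (if l = i then z else 0) - (if l = k then z else 0)" for l
    have sg: "sum g N = 0" using iN k fin by (simp add: g_def sum_subtractf)
    have "(\<Sum>k\<in>N. (a k - b k)\<^sup>2) \<le> (\<Sum>k\<in>N. (a k - g k * (v p - v q) - b k)\<^sup>2)"
    proof (rule no_shift)
      show "d l \<le> a l - g l * (v p - v q)" if "l \<in> N" for l
        using that dx[OF that] db[OF that] \<gamma> ik by (auto simp: g_def a_def \<gamma>_def)
      show "(\<Sum>i\<in>N. x (i, q)) + sum g N \<le> cap q"
        using x pq by (simp add: sg transport_plan_def)
    qed (use pq vv z x_nn x_nn(1)[OF iN pq(2)] x_nn(1)[OF k(1) pq(1)] sg in \<open>auto simp: g_def\<close>)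
    moreover have "(\<Sum>l\<in>N. (a l - g l * (v p - v q) - b l)\<^sup>2 - (a l - b l)\<^sup>2) =
        (\<Sum>l\<in>{i, k}. (a l - g l * (v p - v q) - b l)\<^sup>2 - (a l - b l)\<^sup>2)"
      using iN k fin by (intro sum.mono_neutral_right) (auto simp: g_def)
    moreover have "\<dots> = 2 * \<gamma> * (\<gamma> - (a i - b i) + (a k - b k))"
      using ik by (simp add: g_def power2_eq_square \<gamma>_def algebra_simps)
    moreover have "\<dots> < 0"
      using \<gamma> ak by (intro mult_pos_neg) auto
    ultimately show False by (simp add: sum_subtractf)
  qed
  have "a i \<le> b i" if "i \<in> N" for i
  proof (rule ccontr)
    assume "\<not> a i \<le> b i"
    with that have iR: "i \<in> R" by (simp add: R_def)
    define U where "U = {p \<in> Q. \<exists>i\<in>R. 0 < x (i, p)}"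
    have "(\<Sum>p\<in>Q. x (i, p)) = s i" using x that by (simp add: transport_plan_def)
    then have "\<exists>p\<in>Q. 0 < x (i, p)"
      using s[OF that] sum_nonpos[of Q "\<lambda>p. x (i, p)"] by (force simp: not_less)
    then have "U \<noteq> {}" using iR by (auto simp: U_def)
    moreover have "finite U" using fin by (simp add: U_def)
    \<comment> \<open>The place \<open>p'\<close> is a most expensive one used by a task above its
      bound, so \<open>full\<close> and \<open>closed\<close> apply to every cheaper place.\<close>
    ultimately have "Max (v ` U) \<in> v ` U" by (intro Max_in) auto
    then obtain p' where "p' \<in> U" "v p' = Max (v ` U)" by auto
    then have p': "p' \<in> U" "\<And>p. p \<in> U \<Longrightarrow> v p \<le> v p'" using \<open>finite U\<close> by auto
    obtain i' where i': "i' \<in> R" "p' \<in> Q" "0 < x (i', p')" using p'(1) by (auto simp: U_def)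
    \<comment> \<open>Prices relative to \<open>v p'\<close> permit a comparison place by place.
      Under \<open>x\<close> the cheaper places are filled by tasks of \<open>R\<close> alone, so
      they hold at least as much of \<open>R\<close> as under \<open>x0\<close>, and the factor is
      negative; the dearer places hold nothing of \<open>R\<close> under \<open>x\<close>.\<close>
    have place: "(\<Sum>k\<in>R. x (k, p)) * (v p - v p') \<le> (\<Sum>k\<in>R. x0 (k, p)) * (v p - v p')" if p: "p \<in> Q" for p
    proof (cases "v p < v p'")
      case True
      have "(\<Sum>k\<in>R. x0 (k, p)) \<le> (\<Sum>k\<in>N. x0 (k, p))"
        using RN fin x_nn p by (intro sum_mono2) auto
      also have "\<dots> \<le> cap p" using x0 p by (simp add: transport_plan_def)
      also have "\<dots> = (\<Sum>k\<in>N. x (k, p))" using full[OF i'(1,2) p i'(3) True] by simp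
      also have "\<dots> = (\<Sum>k\<in>R. x (k, p))"
        using closed[OF i'(1,2) p i'(3) True] RN fin x_nn p
        by (intro sum.mono_neutral_right) (auto simp: order.order_iff_strict)
      finally show ?thesis using True by (intro mult_right_mono_neg) auto
    next
      case False
      have "(\<Sum>k\<in>R. x (k, p)) * (v p - v p') = 0"
      proof (cases "v p = v p'")
        case neq: False
        then have "p \<notin> U" using p'(2) False by force
        then have "x (k, p) = 0" if "k \<in> R" for k
          using p that x_nn[of k p] RN by (auto simp: U_def order.order_iff_strict)
        then show ?thesis by simp
      qed simp
      moreover have "0 \<le> (\<Sum>k\<in>R. x0 (k, p)) * (v p - v p')"
        using False RN x_nn p by (intro mult_nonneg_nonneg sum_nonneg) auto
      ultimately show ?thesis by linarith
    qed
    \<comment> \<open>Every plan ships the same total demand of \<open>R\<close>, so passing to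
      relative prices lowers all totals by the same constant.\<close>
    have eq: "(\<Sum>k\<in>R. plan_value Q v x k) - (\<Sum>k\<in>R. s k) * v p' = (\<Sum>p\<in>Q. (\<Sum>k\<in>R. x (k, p)) * (v p - v p'))"
      if "transport_plan N Q s cap x" for x
    proof -
      have "(\<Sum>p\<in>Q. (\<Sum>k\<in>R. x (k, p)) * (v p - v p')) = (\<Sum>k\<in>R. \<Sum>p\<in>Q. x (k, p) * (v p - v p'))"
        by (subst sum.swap) (simp add: sum_distrib_right)
      also have "\<dots> = (\<Sum>k\<in>R. plan_value Q v x k - s k * v p')"
      proof (intro sum.cong refl)
        fix k assume "k \<in> R"
        then have "s k = (\<Sum>p\<in>Q. x (k, p))" using that RN by (auto simp: transport_plan_def)
        then show "(\<Sum>p\<in>Q. x (k, p) * (v p - v p')) = plan_value Q v x k - s k * v p'"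
          by (simp add: plan_value_def right_diff_distrib sum_subtractf sum_distrib_right)
      qed
      finally show ?thesis by (simp add: sum_subtractf sum_distrib_right)
    qed
    have "(\<Sum>p\<in>Q. (\<Sum>k\<in>R. x (k, p)) * (v p - v p')) \<le> (\<Sum>p\<in>Q. (\<Sum>k\<in>R. x0 (k, p)) * (v p - v p'))"
      by (intro sum_mono place)
    then have "(\<Sum>k\<in>R. a k) \<le> (\<Sum>k\<in>R. plan_value Q v x0 k)"
      using eq[OF x] eq[OF x0(1)] unfolding a_def by linarith
    also have "\<dots> \<le> (\<Sum>k\<in>R. b k)" using x0(2) RN by (intro sum_mono) auto
    also have "\<dots> < (\<Sum>k\<in>R. a k)" using iR finR by (intro sum_strict_mono) (auto simp: R_def)
    finally show False by simp
  qed
  then show thesis using that[OF x dx] by (simp add: a_def)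
qed

subsection \<open>Geometric intervals\<close>

text \<open>The point of interval \<open>l\<close> nearest to \<open>t\<close>.\<close>

definition clamp_interval :: "real \<Rightarrow> nat \<Rightarrow> real \<Rightarrow> real" where
  "clamp_interval \<eta> l t = max (left_endpoint \<eta> l) (min t ((1 + \<eta>) ^ l))"

lemma left_endpoint_add_length: "left_endpoint \<eta> l + interval_length \<eta> l = (1 + \<eta>) ^ l"
  by (cases l) (auto simp: left_endpoint_def interval_length_def algebra_simps)

lemma interval_length_pos: "0 < \<eta> \<Longrightarrow> 0 < interval_length \<eta> l"
  by (auto simp: interval_length_def)

lemma sum_interval_length: "0 < \<eta> \<Longrightarrow> (\<Sum>l\<le>n. interval_length \<eta> l) = (1 + \<eta>) ^ n"
  by (induction n) (auto simp: interval_length_def algebra_simps)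

lemma left_endpoint_le_iff:
  assumes "0 < \<eta>"
  shows "left_endpoint \<eta> l \<le> left_endpoint \<eta> l' \<longleftrightarrow> l \<le> l'"
proof -
  have "left_endpoint \<eta> n < left_endpoint \<eta> (Suc n)" for n
    using assms by (cases n) (auto simp: left_endpoint_def)
  then have "strict_mono (left_endpoint \<eta>)"
    by (simp add: strict_mono_Suc_iff)
  then show ?thesis by (rule strict_mono_less_eq)
qed

lemma clamp_interval_mono: "s \<le> t \<Longrightarrow> clamp_interval \<eta> l s \<le> clamp_interval \<eta> l t"
  by (auto simp: clamp_interval_def)

lemma clamp_interval_bounds:
  assumes "0 < \<eta>"
  shows "left_endpoint \<eta> l \<le> clamp_interval \<eta> l t" "clamp_interval \<eta> l t \<le> (1 + \<eta>) ^ l"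
  using left_endpoint_add_length[of \<eta> l] interval_length_pos[OF assms, of l]
  by (auto simp: clamp_interval_def)

text \<open>Consecutive intervals share an endpoint, so the sum telescopes. The identity as
  \<open>g\<close> yields durations, the square yields twice the integral of time.\<close>

lemma sum_clamp_interval:
  fixes g :: "real \<Rightarrow> real"
  assumes "0 < \<eta>" "0 \<le> t"
  shows "(\<Sum>l\<le>n. g (clamp_interval \<eta> l t) - g (left_endpoint \<eta> l)) = g (min t ((1 + \<eta>) ^ n)) - g 0"
proof (induction n)
  case 0
  then show ?case using assms by (simp add: clamp_interval_def left_endpoint_def max_def)
next
  case (Suc n)
  have le: "(1 + \<eta>) ^ n \<le> (1 + \<eta>) ^ Suc n" using assms by (intro power_increasing) auto
  have "g (clamp_interval \<eta> (Suc n) t) - g (left_endpoint \<eta> (Suc n)) =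
      g (min t ((1 + \<eta>) ^ Suc n)) - g (min t ((1 + \<eta>) ^ n))"
  proof (cases "t \<le> (1 + \<eta>) ^ n")
    case True
    then have "clamp_interval \<eta> (Suc n) t = (1 + \<eta>) ^ n" "min t ((1 + \<eta>) ^ n) = t"
      "min t ((1 + \<eta>) ^ Suc n) = t"
      using le by (simp_all add: clamp_interval_def left_endpoint_def)
    then show ?thesis by (simp add: left_endpoint_def)
  next
    case False
    then have "(1 + \<eta>) ^ n \<le> min t ((1 + \<eta>) ^ Suc n)" using le by linarith
    then show ?thesis using False by (simp add: clamp_interval_def left_endpoint_def)
  qed
  then show ?case using Suc by simp
qed

text \<open>For \<open>s \<le> t\<close> this is the length of the part of the run from
  \<open>s\<close> to \<open>t\<close> that lies in interval \<open>l\<close>.\<close>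

definition processed :: "real \<Rightarrow> real \<Rightarrow> real \<Rightarrow> nat \<Rightarrow> real" where
  "processed \<eta> s t l = clamp_interval \<eta> l t - clamp_interval \<eta> l s"

lemma sum_processed:
  assumes "0 < \<eta>" "0 \<le> s" "s \<le> t" "t \<le> (1 + \<eta>) ^ n"
  shows "(\<Sum>l\<le>n. processed \<eta> s t l) = t - s"
  using sum_clamp_interval[of \<eta> t "\<lambda>u. u" n] sum_clamp_interval[of \<eta> s "\<lambda>u. u" n] assms
  by (simp add: processed_def sum_subtractf)

text \<open>The part of a task processed within an interval has its midpoint after the left endpoint; in
  \<open>[0, 1]\<close> the midpoint is at least \<open>1/2\<close> because a task of service time at least \<open>1\<close>
  does not end within the interval.\<close>

lemma sum_processed_lp_start_le:
  assumes \<eta>: "0 < \<eta>" and s: "0 \<le> s" "s + 1 \<le> t" and t: "t \<le> (1 + \<eta>) ^ n"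
  shows "(\<Sum>l\<le>n. processed \<eta> s t l * lp_start \<eta> l) \<le> (t\<^sup>2 - s\<^sup>2) / 2"
proof -
  have "(\<Sum>l\<le>n. processed \<eta> s t l * lp_start \<eta> l) \<le>
      (\<Sum>l\<le>n. ((clamp_interval \<eta> l t)\<^sup>2 - (clamp_interval \<eta> l s)\<^sup>2) / 2)"
  proof (rule sum_mono)
    fix l
    have "0 \<le> processed \<eta> s t l" using s by (auto simp: processed_def intro: clamp_interval_mono)
    moreover have "lp_start \<eta> l \<le> (clamp_interval \<eta> l t + clamp_interval \<eta> l s) / 2"
    proof (cases "l = 0")
      case True
      then show ?thesis using s by (auto simp: lp_start_def clamp_interval_def left_endpoint_def)
    next
      case False
      then show ?thesis using clamp_interval_bounds(1)[OF \<eta>, of l t] clamp_interval_bounds(1)[OF \<eta>, of l s]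
        by (auto simp: lp_start_def left_endpoint_def)
    qed
    ultimately have "processed \<eta> s t l * lp_start \<eta> l \<le>
        processed \<eta> s t l * ((clamp_interval \<eta> l t + clamp_interval \<eta> l s) / 2)"
      by (rule mult_left_mono[rotated])
    \<comment> \<open>Length times midpoint is the integral of time over the part, a difference of
      squares that telescopes over \<open>l\<close>.\<close>
    also have "\<dots> = ((clamp_interval \<eta> l t)\<^sup>2 - (clamp_interval \<eta> l s)\<^sup>2) / 2"
      by (simp add: processed_def power2_eq_square algebra_simps)
    finally show "processed \<eta> s t l * lp_start \<eta> l \<le> \<dots>" .
  qed
  also have "\<dots> = ((\<Sum>l\<le>n. (clamp_interval \<eta> l t)\<^sup>2 - (left_endpoint \<eta> l)\<^sup>2) -
      (\<Sum>l\<le>n. (clamp_interval \<eta> l s)\<^sup>2 - (left_endpoint \<eta> l)\<^sup>2)) / 2"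
    by (simp add: sum_subtractf flip: sum_divide_distrib)
  also have "\<dots> = (t\<^sup>2 - s\<^sup>2) / 2"
    using sum_clamp_interval[of \<eta> t power2 n] sum_clamp_interval[of \<eta> s power2 n] assms by simp
  finally show ?thesis .
qed

section \<open>Telescoping sums along a linear order\<close>

lemma linear_order_has_last:
  assumes "finite A" "A \<noteq> {}" "linear_order_on B r" "A \<subseteq> B"
  obtains z where "z \<in> A" "\<And>k. k \<in> A \<Longrightarrow> (k, z) \<in> r"
proof -
  have "\<exists>z\<in>A. \<forall>k\<in>A. (k, z) \<in> r"
    using assms(1,2,4)
  proof (induction A rule: finite_ne_induct)
    case (singleton x)
    then show ?case using assms(3) by (auto simp: order_on_defs refl_on_def)
  next
    case (insert x F)
    then obtain z where z: "z \<in> F" "\<forall>k\<in>F. (k, z) \<in> r" by auto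
    have tot: "total_on B r" and tr: "trans r" and re: "refl_on B r"
      using assms(3) by (auto simp: order_on_defs)
    show ?case
    proof (cases "(x, z) \<in> r")
      case True
      then show ?thesis using z by auto
    next
      case False
      then have "(z, x) \<in> r" using tot z insert by (auto simp: total_on_def)
      then have "\<forall>k\<in>F. (k, x) \<in> r" using z tr by (meson transD)
      then show ?thesis using re insert by (auto simp: refl_on_def)
    qed
  qed
  then show thesis using that by blast
qed

text \<open>Each prefix sum is where the next element starts, so the increments of \<open>F\<close>
  telescope; the induction removes the last element. With a clamping function as \<open>F\<close>
  this bounds the work that one worker does inside one interval.\<close>

lemma sum_telescope_order:
  fixes F :: "real \<Rightarrow> real" and s :: "'a \<Rightarrow> real"
  assumes "finite A" "linear_order_on B r" "A \<subseteq> B"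
  shows "(\<Sum>i\<in>A. F (\<Sum>k | k \<in> A \<and> (k, i) \<in> r. s k) - F ((\<Sum>k | k \<in> A \<and> (k, i) \<in> r. s k) - s i)) =
    F (sum s A) - F 0"
  using assms
proof (induction "card A" arbitrary: A)
  case 0
  then show ?case by simp
next
  case (Suc n)
  then have "A \<noteq> {}" by auto
  from linear_order_has_last[OF Suc.prems(1) this Suc.prems(2,3)]
  obtain z where z: "z \<in> A" "\<And>k. k \<in> A \<Longrightarrow> (k, z) \<in> r" by blast
  have "antisym r" using assms(2) by (auto simp: order_on_defs)
  \<comment> \<open>The last element \<open>z\<close> precedes no other element, so removing it
    leaves the remaining prefixes unchanged.\<close>
  then have eq: "{k. k \<in> A \<and> (k, i) \<in> r} = {k. k \<in> A - {z} \<and> (k, i) \<in> r}" if "i \<in> A - {z}" for i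
    using that z by (auto dest: antisymD)
  have "{k. k \<in> A \<and> (k, z) \<in> r} = A" using z by auto
  moreover have "sum s A = s z + sum s (A - {z})" using z Suc.prems by (simp add: sum.remove)
  moreover have "n = card (A - {z})" "finite (A - {z})" "A - {z} \<subseteq> B"
    using Suc.hyps(2) Suc.prems z by auto
  note Suc.hyps(1)[OF this(1,2) Suc.prems(2) this(3)]
  ultimately show ?case
    using z Suc.prems by (subst sum.remove[of A z]) (simp_all add: eq)
qed

subsection \<open>The linear program as a relaxation\<close>

definition interval_cap :: "real \<Rightarrow> nat \<times> nat \<Rightarrow> real" where
  "interval_cap \<eta> = (\<lambda>(j, l). interval_length \<eta> l)"

definition pair_start :: "real \<Rightarrow> crowd \<Rightarrow> nat \<times> nat \<Rightarrow> real" where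
  "pair_start \<eta> I = (\<lambda>(j, l). delay I j + lp_start \<eta> l)"

text \<open>Scaling by the interval length turns the variables into amounts of processing time, for
  which the program is a transportation problem.\<close>

definition lp_plan :: "real \<Rightarrow> lp_vars \<Rightarrow> nat \<times> nat \<times> nat \<Rightarrow> real" where
  "lp_plan \<eta> y = (\<lambda>(i, j, l). y i j l * interval_length \<eta> l)"

lemma finite_worker_intervals [simp]: "finite (worker_intervals \<eta> I)"
  by (simp add: worker_intervals_def)

lemma sum_worker_intervals:
  "(\<Sum>p\<in>worker_intervals \<eta> I. f p) = (\<Sum>j<workers I. \<Sum>l\<le>top_interval \<eta> I. f (j, l))"
  by (simp add: worker_intervals_def sum.cartesian_product)

text \<open>Since the amounts of task \<open>i\<close> add up to its service time, the half-weighted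
  part of \<open>C i\<close> is the constant \<open>service I i / 2\<close>, and the lower bound on
  \<open>C i\<close> is the service time itself.\<close>

lemma lp_feasible_iff:
  assumes "crowd_instance I" "0 < \<eta>"
  shows "lp_feasible \<eta> I y C \<longleftrightarrow>
    transport_plan {..<tasks I} (worker_intervals \<eta> I) (service I) (interval_cap \<eta>) (lp_plan \<eta> y) \<and>
    (\<forall>i<tasks I. C i =
      plan_value (worker_intervals \<eta> I) (pair_start \<eta> I) (lp_plan \<eta> y) i / service I i + service I i / 2) \<and>
    (\<forall>i<tasks I. service I i \<le> C i)"
proof -
  let ?Q = "worker_intervals \<eta> I"
  have s: "0 < service I i" if "i < tasks I" for i using assms that by (auto simp: crowd_instance_def)
  note len = interval_length_pos[OF assms(2)]
  define row where "row i = (\<Sum>p\<in>?Q. lp_plan \<eta> y (i, p))" for i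
  have row_alt: "row i = (\<Sum>j<workers I. \<Sum>l\<le>top_interval \<eta> I. y i j l * interval_length \<eta> l)" for i
    by (simp add: row_def sum_worker_intervals lp_plan_def)
  have "0 \<le> u * interval_length \<eta> l \<longleftrightarrow> 0 \<le> u" for u l
    using len[of l] by (auto simp: zero_le_mult_iff)
  then have "(\<forall>i<tasks I. \<forall>j<workers I. \<forall>l\<le>top_interval \<eta> I. 0 \<le> y i j l) \<longleftrightarrow>
      (\<forall>i\<in>{..<tasks I}. \<forall>p\<in>?Q. 0 \<le> lp_plan \<eta> y (i, p))"
    by (auto simp: worker_intervals_def lp_plan_def)
  moreover have "(\<forall>i<tasks I.
        (\<Sum>j<workers I. \<Sum>l\<le>top_interval \<eta> I. y i j l * interval_length \<eta> l / service I i) = 1) \<longleftrightarrow>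
      (\<forall>i\<in>{..<tasks I}. row i = service I i)"
    using s by (force simp: row_alt simp flip: sum_divide_distrib)
  moreover have "(\<forall>j<workers I. \<forall>l\<le>top_interval \<eta> I. (\<Sum>i<tasks I. y i j l) \<le> 1) \<longleftrightarrow>
      (\<forall>p\<in>?Q. (\<Sum>i<tasks I. lp_plan \<eta> y (i, p)) \<le> interval_cap \<eta> p)"
    using mult_le_cancel_right_pos[OF len, where b = 1]
    by (auto simp: worker_intervals_def lp_plan_def interval_cap_def simp flip: sum_distrib_right)
  moreover have "(\<Sum>j<workers I. \<Sum>l\<le>top_interval \<eta> I.
           y i j l * interval_length \<eta> l / service I i * (delay I j + lp_start \<eta> l)
           + 1 / 2 * y i j l * interval_length \<eta> l) =
      plan_value ?Q (pair_start \<eta> I) (lp_plan \<eta> y) i / service I i + row i / 2" for i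
    by (simp add: plan_value_def row_alt sum_worker_intervals lp_plan_def pair_start_def sum.distrib
        sum_divide_distrib)
  ultimately show ?thesis
    unfolding lp_feasible_def transport_plan_def row_alt[symmetric] row_def[symmetric] by auto
qed

text \<open>The intervals in use are long enough for one worker to process everything. If the
  logarithm is negative, \<open>nat\<close> raises the exponent to 0, which only enlarges the
  right-hand side.\<close>

lemma sum_service_le_horizon:
  assumes "crowd_instance I" "0 < \<eta>"
  shows "(\<Sum>i<tasks I. service I i) \<le> (1 + \<eta>) ^ top_interval \<eta> I"
proof -
  have pos: "0 < (\<Sum>i<tasks I. service I i)"
    using assms by (intro sum_pos) (auto simp: crowd_instance_def)
  have "log (1 + \<eta>) (\<Sum>i<tasks I. service I i) \<le> real (top_interval \<eta> I)"
    unfolding top_interval_def by linarith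
  then have "(\<Sum>i<tasks I. service I i) \<le> (1 + \<eta>) powr real (top_interval \<eta> I)"
    using pos assms by (subst (asm) log_le_iff) auto
  then show ?thesis using assms by (simp add: powr_realpow)
qed

text \<open>Each task is spread over the intervals of its worker according to its run. The bound on
  its value is delay times service time plus the integral of time over the run.\<close>

lemma schedule_transport_plan:
  fixes S :: schedule
  assumes I: "crowd_instance I" "\<forall>i<tasks I. 1 \<le> service I i" and \<eta>: "0 < \<eta>" and S: "S \<in> schedules I"
  obtains x where
    "transport_plan {..<tasks I} (worker_intervals \<eta> I) (service I) (interval_cap \<eta>) x"
    "\<And>i. i < tasks I \<Longrightarrow> plan_value (worker_intervals \<eta> I) (pair_start \<eta> I) x i \<le>
      service I i * (completion I S i - service I i / 2)"
    "\<And>i. i < tasks I \<Longrightarrow> service I i \<le> completion I S i"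
proof -
  let ?n = "top_interval \<eta> I"
  \<comment> \<open>Time is counted from the end of the worker's delay, because the program adds the
    delay to the interval starts separately.\<close>
  define c where "c i = completion I S i - delay I (fst S i)" for i
  define A where "A j = {k. k < tasks I \<and> fst S k = j}" for j
  have c: "c i = (\<Sum>k | k \<in> A j \<and> (k, i) \<in> snd S. service I k)" if "i \<in> A j" for i j
    using that unfolding c_def completion_def A_def by (auto intro!: sum.cong)
  have lin: "linear_order_on {..<tasks I} (snd S)" and worker: "\<And>i. i < tasks I \<Longrightarrow> fst S i < workers I"
    using S by (simp_all add: schedules_def split_beta PiE_iff)
  have A: "finite (A j)" "A j \<subseteq> {..<tasks I}" for j by (auto simp: A_def)
  have s: "0 \<le> service I i" if "i < tasks I" for i
    using I(2)[rule_format, OF that] by simp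
  have c_ge: "service I i \<le> c i" if "i < tasks I" for i
  proof -
    have "i \<in> {k. k \<in> A (fst S i) \<and> (k, i) \<in> snd S}"
      using that lin by (auto simp: A_def order_on_defs refl_on_def)
    then have "service I i \<le> (\<Sum>k | k \<in> A (fst S i) \<and> (k, i) \<in> snd S. service I k)"
      using A s by (intro member_le_sum) (auto simp: A_def)
    then show ?thesis using c[of i "fst S i"] that by (simp add: A_def)
  qed
  have total: "sum (service I) (A j) \<le> (1 + \<eta>) ^ ?n" for j
  proof -
    have "sum (service I) (A j) \<le> sum (service I) {..<tasks I}"
      using A s by (intro sum_mono2) auto
    then show ?thesis using sum_service_le_horizon[OF I(1) \<eta>] by linarith
  qed
  have c_le: "c i \<le> (1 + \<eta>) ^ ?n" if "i < tasks I" for i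
  proof -
    have "i \<in> A (fst S i)" using that by (simp add: A_def)
    then have "c i \<le> sum (service I) (A (fst S i))"
      unfolding c[OF \<open>i \<in> A (fst S i)\<close>] using A s by (intro sum_mono2) (auto simp: A_def)
    then show ?thesis using total[of "fst S i"] by linarith
  qed
  define x where "x = (\<lambda>(i, j, l). if fst S i = j then processed \<eta> (c i - service I i) (c i) l else 0)"
  have row: "(\<Sum>p\<in>worker_intervals \<eta> I. x (i, p) * f p) =
      (\<Sum>l\<le>?n. processed \<eta> (c i - service I i) (c i) l * f (fst S i, l))" if "i < tasks I" for i f
  proof -
    have "(\<Sum>p\<in>worker_intervals \<eta> I. x (i, p) * f p) =
      (\<Sum>j<workers I. if j = fst S i then \<Sum>l\<le>?n. processed \<eta> (c i - service I i) (c i) l * f (j, l) else 0)"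
      unfolding sum_worker_intervals by (intro sum.cong) (auto simp: x_def)
    then show ?thesis using worker[OF that] by simp
  qed
  have row1: "(\<Sum>p\<in>worker_intervals \<eta> I. x (i, p)) = service I i" if "i < tasks I" for i
    using row[OF that, of "\<lambda>_. 1"] sum_processed[OF \<eta>, of "c i - service I i" "c i" ?n]
      c_ge[OF that] c_le[OF that] s[OF that] by simp
  show thesis
  proof (rule that[of x])
    have "(\<Sum>i<tasks I. x (i, j, l)) \<le> interval_length \<eta> l" for j l
    proof -
      have "(\<Sum>i<tasks I. x (i, j, l)) = (\<Sum>i\<in>A j. processed \<eta> (c i - service I i) (c i) l)"
        by (simp add: x_def A_def sum.If_cases Int_def)
      also have "\<dots> = (\<Sum>i\<in>A j. clamp_interval \<eta> l (\<Sum>k | k \<in> A j \<and> (k, i) \<in> snd S. service I k) -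
          clamp_interval \<eta> l ((\<Sum>k | k \<in> A j \<and> (k, i) \<in> snd S. service I k) - service I i))"
        by (intro sum.cong) (auto simp: processed_def c)
      \<comment> \<open>Telescoping: the runs of worker \<open>j\<close> together occupy a segment
        that starts at 0, which meets interval \<open>l\<close> in at most its length.\<close>
      also have "\<dots> = clamp_interval \<eta> l (sum (service I) (A j)) - clamp_interval \<eta> l 0"
        using A lin by (intro sum_telescope_order) auto
      also have "\<dots> \<le> interval_length \<eta> l"
        using clamp_interval_bounds[OF \<eta>, of l "sum (service I) (A j)"]
          clamp_interval_bounds[OF \<eta>, of l 0] left_endpoint_add_length[of \<eta> l] by linarith
      finally show ?thesis .
    qed
    moreover have "0 \<le> x (i, p)" if "i < tasks I" for i p
      using s[OF that] by (auto simp: x_def processed_def split: prod.split intro: clamp_interval_mono)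
    ultimately show "transport_plan {..<tasks I} (worker_intervals \<eta> I) (service I) (interval_cap \<eta>) x"
      using row1 by (auto simp: transport_plan_def interval_cap_def)
  next
    fix i assume i: "i < tasks I"
    have "plan_value (worker_intervals \<eta> I) (pair_start \<eta> I) x i =
        (\<Sum>l\<le>?n. processed \<eta> (c i - service I i) (c i) l) * delay I (fst S i) +
        (\<Sum>l\<le>?n. processed \<eta> (c i - service I i) (c i) l * lp_start \<eta> l)"
      unfolding plan_value_def row[OF i] by (simp add: pair_start_def algebra_simps sum.distrib sum_distrib_left)
    also have "\<dots> \<le> service I i * delay I (fst S i) + ((c i)\<^sup>2 - (c i - service I i)\<^sup>2) / 2"
      using sum_processed[OF \<eta>, of "c i - service I i" "c i" ?n]
        sum_processed_lp_start_le[OF \<eta>, of "c i - service I i" "c i" ?n] c_ge[OF i] c_le[OF i]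
        I(2)[rule_format, OF i] by simp
    \<comment> \<open>The difference of squares is
      \<open>service I i * (2 * c i - service I i)\<close>; adding the delay turns
      \<open>c i\<close> back into the completion time.\<close>
    also have "\<dots> = service I i * (completion I S i - service I i / 2)"
      by (simp add: c_def power2_eq_square field_simps)
    finally show "plan_value (worker_intervals \<eta> I) (pair_start \<eta> I) x i \<le> \<dots>" .
    have "0 \<le> delay I (fst S i)"
      using I(1) worker[OF i] by (simp add: crowd_instance_def delay_def less_imp_le)
    then show "service I i \<le> completion I S i" using c_ge[OF i] by (simp add: c_def)
  qed
qed

text \<open>The schedule supplies \<open>x0\<close> and the given feasible solution supplies
  \<open>x1\<close> for the exchange argument. The resulting plan is feasible and no worse than the
  schedule for any task, so optimality of \<open>C\<close> gives the bound.\<close>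

lemma lp_objective_le_total_cost:
  assumes I: "crowd_instance I" "\<forall>i<tasks I. 1 \<le> service I i" and \<eta>: "0 < \<eta>"
    and opt: "lp_optimal \<eta> I y C" and S: "S \<in> schedules I"
  shows "lp_objective I C \<le> total_cost I S"
proof -
  let ?N = "{..<tasks I}" and ?Q = "worker_intervals \<eta> I"
  let ?plan = "transport_plan ?N ?Q (service I) (interval_cap \<eta>)"
  let ?val = "plan_value ?Q (pair_start \<eta> I)"
  have s: "0 < service I i" if "i \<in> ?N" for i using I(1) that by (auto simp: crowd_instance_def)
  from schedule_transport_plan[OF I \<eta> S] obtain x0 where x0: "?plan x0"
    "\<And>i. i \<in> ?N \<Longrightarrow> ?val x0 i \<le> service I i * (completion I S i - service I i / 2)"
    "\<And>i. i \<in> ?N \<Longrightarrow> service I i \<le> completion I S i"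
    by (metis lessThan_iff)
  have feas: "lp_feasible \<eta> I y C" using opt by (simp add: lp_optimal_def)
  have x1: "?plan (lp_plan \<eta> y)" using feas unfolding lp_feasible_iff[OF I(1) \<eta>] by blast
  \<comment> \<open>The demand \<open>service I i \<le> C i\<close> in terms of plan values: the
    constant part of \<open>C i\<close> covers half of the service time.\<close>
  have dx1: "service I i * (service I i / 2) \<le> ?val (lp_plan \<eta> y) i" if i: "i \<in> ?N" for i
  proof -
    have "service I i \<le> ?val (lp_plan \<eta> y) i / service I i + service I i / 2"
      using feas i unfolding lp_feasible_iff[OF I(1) \<eta>] by auto
    then have "service I i / 2 \<le> ?val (lp_plan \<eta> y) i / service I i" by linarith
    then show ?thesis using s[OF i] by (simp add: pos_le_divide_eq mult.commute)
  qed
  have db: "service I i * (service I i / 2) \<le> service I i * (completion I S i - service I i / 2)"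
    if "i \<in> ?N" for i
    using s[OF that] x0(3)[OF that] by (intro mult_left_mono) auto
  obtain x where x: "?plan x"
    "\<And>i. i \<in> ?N \<Longrightarrow> service I i * (service I i / 2) \<le> ?val x i"
    "\<And>i. i \<in> ?N \<Longrightarrow> ?val x i \<le> service I i * (completion I S i - service I i / 2)"
    using transport_exchange[OF _ _ s db x0(1,2) x1 dx1] by auto
  define y' where "y' i j l = x (i, j, l) / interval_length \<eta> l" for i j l
  define C' where "C' i = ?val x i / service I i + service I i / 2" for i
  have y': "lp_plan \<eta> y' = x"
    using interval_length_pos[OF \<eta>] by (auto simp: lp_plan_def y'_def less_imp_neq[symmetric])
  have "lp_feasible \<eta> I y' C'"
    unfolding lp_feasible_iff[OF I(1) \<eta>] y' using x(1,2) s by (auto simp: C'_def field_simps)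
  then have "lp_objective I C \<le> lp_objective I C'"
    using opt by (auto simp: lp_optimal_def)
  also have "\<dots> \<le> total_cost I S"
    unfolding lp_objective_def total_cost_def
  proof (intro sum_mono mult_left_mono)
    fix i assume i: "i \<in> ?N"
    then show "C' i \<le> completion I S i"
      using x(3)[OF i] s[OF i] by (simp add: C'_def field_simps)
    show "0 \<le> weight I i" using I(1) i by (auto simp: crowd_instance_def less_imp_le)
  qed
  finally show ?thesis .
qed

subsection \<open>Random assignment and conditional expectations\<close>

lemma
  assumes "crowd_instance I" "0 < \<eta>" "lp_feasible \<eta> I y C" "i < tasks I"
  shows pmf_task_pmf: "(j, l) \<in> worker_intervals \<eta> I \<Longrightarrow>
      pmf (task_pmf \<eta> I y i) (j, l) = y i j l * interval_length \<eta> l / service I i"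
    and set_task_pmf_subset: "set_pmf (task_pmf \<eta> I y i) \<subseteq> worker_intervals \<eta> I"
proof -
  let ?Q = "worker_intervals \<eta> I"
  define f where "f = (\<lambda>(j, l). if (j, l) \<in> ?Q then y i j l * interval_length \<eta> l / service I i else 0)"
  have s: "0 < service I i" using assms by (auto simp: crowd_instance_def)
  have nn: "0 \<le> f p" for p
    using assms s interval_length_pos[OF assms(2), THEN less_imp_le]
    by (auto simp: f_def lp_feasible_def worker_intervals_def split: prod.split
        intro!: divide_nonneg_pos mult_nonneg_nonneg)
  have "(\<integral>\<^sup>+p. ennreal (f p) \<partial>count_space UNIV) = (\<Sum>p\<in>?Q. ennreal (f p))"
    by (rule nn_integral_count_space'[where A = ?Q, THEN trans]) (auto simp: f_def split: if_splits)
  also have "\<dots> = ennreal (\<Sum>p\<in>?Q. f p)" using nn by simp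
  also have "(\<Sum>p\<in>?Q. f p) = 1"
    using assms(3,4) unfolding sum_worker_intervals
    by (simp add: f_def worker_intervals_def lp_feasible_def)
  finally have one: "(\<integral>\<^sup>+p. ennreal (f p) \<partial>count_space UNIV) = 1" by simp
  have pmf: "pmf (task_pmf \<eta> I y i) p = f p" for p
    unfolding task_pmf_def f_def[symmetric] by (rule pmf_embed_pmf[OF nn one])
  show "(j, l) \<in> ?Q \<Longrightarrow> pmf (task_pmf \<eta> I y i) (j, l) = y i j l * interval_length \<eta> l / service I i"
    by (simp add: pmf f_def)
  show "set_pmf (task_pmf \<eta> I y i) \<subseteq> ?Q"
    by (auto simp: set_pmf_eq pmf f_def split: if_splits)
qed

lemma finite_set_Pi_pmf:
  assumes "finite A" "\<And>i. i \<in> A \<Longrightarrow> finite (set_pmf (p i))"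
  shows "finite (set_pmf (Pi_pmf A d p))"
  by (rule finite_subset[OF set_Pi_pmf_subset'[OF assms(1)]]) (use assms in auto)

text \<open>Conditioning on the independent coordinate \<open>i\<close>. The set \<open>Q\<close>
  may exceed the support: it is taken to be all worker-interval pairs, or a single pair for a task
  already fixed.\<close>

lemma expectation_Pi_pmf_insert:
  fixes h :: "('a \<Rightarrow> 'b) \<Rightarrow> real"
  assumes "finite A" "i \<notin> A" "\<And>k. k \<in> A \<Longrightarrow> finite (set_pmf (p k))" "finite Q" "set_pmf (p i) \<subseteq> Q"
  shows "measure_pmf.expectation (Pi_pmf (insert i A) d p) h =
    (\<Sum>q\<in>Q. pmf (p i) q * measure_pmf.expectation (Pi_pmf A d p) (\<lambda>f. h (f(i := q))))"
  using assms finite_set_Pi_pmf[OF assms(1,3)]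
  by (simp add: Pi_pmf_insert' pmf_expectation_bind[of Q] flip: map_pmf_def)

text \<open>Left endpoints are ordered like interval indices. The bound counts every task in the
  same interval of the same worker as preceding \<open>i\<close>, whatever its index, so the tie
  rule disappears.\<close>

lemma completion_induced_schedule_le:
  assumes "crowd_instance I" "0 < \<eta>" "i < tasks I"
  shows "completion I (induced_schedule \<eta> I z) i \<le> delay I (fst (z i)) + service I i +
    (\<Sum>k\<in>{..<tasks I} - {i}. service I k * of_bool (fst (z k) = fst (z i) \<and> snd (z k) \<le> snd (z i)))"
proof -
  let ?B = "{k \<in> {..<tasks I} - {i}. fst (z k) = fst (z i) \<and> snd (z k) \<le> snd (z i)}"
  have s: "0 \<le> service I k" if "k < tasks I" for k
    using assms(1) that by (auto simp: crowd_instance_def less_imp_le)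
  let ?r = "snd (induced_schedule \<eta> I z)" and ?a = "fst (induced_schedule \<eta> I z)"
  have "{k. k < tasks I \<and> ?a k = ?a i \<and> (k, i) \<in> ?r} \<subseteq> insert i ?B"
    using assms(3) left_endpoint_le_iff[OF assms(2)]
    by (auto simp: induced_schedule_def intro: less_imp_le eq_refl)
  then have "(\<Sum>k | k < tasks I \<and> ?a k = ?a i \<and> (k, i) \<in> ?r. service I k) \<le>
      (\<Sum>k\<in>insert i ?B. service I k)"
    using s assms(3) by (intro sum_mono2) auto
  also have "\<dots> = service I i + (\<Sum>k\<in>?B. service I k)"
    by (subst sum.insert) auto
  also have "(\<Sum>k\<in>?B. service I k) =
      (\<Sum>k\<in>{..<tasks I} - {i}. service I k * of_bool (fst (z k) = fst (z i) \<and> snd (z k) \<le> snd (z i)))"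
    by (intro sum.mono_neutral_cong_left) auto
  finally show ?thesis
    using assms(3) by (simp add: completion_def induced_schedule_def)
qed

text \<open>Once the pair of task \<open>i\<close> is fixed, the other tasks are still independent
  of it. Averaging over that pair uses the same weights as the formula for \<open>C i\<close>, so it
  suffices to compare the two pair by pair.\<close>

lemma expected_completion_le:
  assumes I: "crowd_instance I" and \<eta>: "0 < \<eta>" and y: "lp_feasible \<eta> I y C" and i: "i < tasks I"
  shows "measure_pmf.expectation (Pi_pmf {..<tasks I} undefined (task_pmf \<eta> I y))
      (\<lambda>z. completion I (induced_schedule \<eta> I z) i) \<le> max 2 (1 + \<eta>) * C i"
proof -
  let ?Q = "worker_intervals \<eta> I" and ?A = "{..<tasks I} - {i}"
  let ?P = "Pi_pmf ?A undefined (task_pmf \<eta> I y)"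
  define c where "c = max 2 (1 + \<eta>)"
  define w where "w j l = y i j l * interval_length \<eta> l / service I i" for j l
  have s: "0 < service I k" if "k < tasks I" for k using I that by (auto simp: crowd_instance_def)
  have fin: "finite (set_pmf (task_pmf \<eta> I y k))" if "k < tasks I" for k
    using set_task_pmf_subset[OF I \<eta> y that] by (rule finite_subset) simp
  have int: "integrable ?P f" for f :: "_ \<Rightarrow> real"
    using fin by (intro integrable_measure_pmf_finite finite_set_Pi_pmf) auto
  have rest: "measure_pmf.expectation ?P (\<lambda>f. completion I (induced_schedule \<eta> I (f(i := (j, l)))) i) \<le>
      delay I j + service I i + (1 + \<eta>) ^ l" if q: "(j, l) \<in> ?Q" for j l
  proof -
    \<comment> \<open>Indicator that a task drawn at pair \<open>p\<close> may delay task
      \<open>i\<close> placed at \<open>(j, l)\<close>.\<close>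
    define \<phi> :: "nat \<times> nat \<Rightarrow> real" where "\<phi> p = of_bool (fst p = j \<and> snd p \<le> l)" for p
    have single: "measure_pmf.expectation ?P (\<lambda>f. \<phi> (f k)) =
        (\<Sum>t\<le>l. y k j t * interval_length \<eta> t / service I k)" if k: "k \<in> ?A" for k
    proof -
      have kn: "k < tasks I" using k by simp
      have "measure_pmf.expectation ?P (\<lambda>f. \<phi> (f k)) =
          measure_pmf.expectation (map_pmf (\<lambda>f. f k) ?P) \<phi>" by simp
      also have "\<dots> = measure_pmf.expectation (task_pmf \<eta> I y k) \<phi>"
        using k by (subst Pi_pmf_component) auto
      also have "\<dots> = (\<Sum>p\<in>?Q. pmf (task_pmf \<eta> I y k) p * \<phi> p)"
        using set_task_pmf_subset[OF I \<eta> y kn] by (subst integral_measure_pmf[of ?Q]) auto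
      also have "\<dots> = (\<Sum>p\<in>Pair j ` {..l}. pmf (task_pmf \<eta> I y k) p)"
        using q by (intro sum.mono_neutral_cong_right) (auto simp: worker_intervals_def \<phi>_def)
      also have "\<dots> = (\<Sum>t\<le>l. pmf (task_pmf \<eta> I y k) (j, t))"
        by (simp add: sum.reindex inj_on_def)
      also have "\<dots> = (\<Sum>t\<le>l. y k j t * interval_length \<eta> t / service I k)"
        using q by (intro sum.cong refl pmf_task_pmf[OF I \<eta> y kn]) (auto simp: worker_intervals_def)
      finally show ?thesis .
    qed
    have "measure_pmf.expectation ?P (\<lambda>f. completion I (induced_schedule \<eta> I (f(i := (j, l)))) i) \<le>
        measure_pmf.expectation ?P (\<lambda>f. delay I j + service I i + (\<Sum>k\<in>?A. service I k * \<phi> (f k)))"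
    proof (rule integral_mono[OF int int])
      fix f
      let ?g = "f(i := (j, l))"
      have eq: "(\<Sum>k\<in>?A. service I k * of_bool (fst (?g k) = fst (?g i) \<and> snd (?g k) \<le> snd (?g i))) =
          (\<Sum>k\<in>?A. service I k * \<phi> (f k))"
        by (intro sum.cong) (auto simp: \<phi>_def)
      show "completion I (induced_schedule \<eta> I (f(i := (j, l)))) i \<le>
          delay I j + service I i + (\<Sum>k\<in>?A. service I k * \<phi> (f k))"
        using completion_induced_schedule_le[OF I \<eta> i, of ?g] unfolding eq by simp
    qed
    also have "\<dots> = delay I j + service I i + (\<Sum>k\<in>?A. service I k * measure_pmf.expectation ?P (\<lambda>f. \<phi> (f k)))"
      using int by (simp add: Bochner_Integration.integral_sum)
    also have "(\<Sum>k\<in>?A. service I k * measure_pmf.expectation ?P (\<lambda>f. \<phi> (f k))) =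
        (\<Sum>k\<in>?A. \<Sum>t\<le>l. y k j t * interval_length \<eta> t)"
    proof (intro sum.cong refl)
      fix k assume k: "k \<in> ?A"
      then show "service I k * measure_pmf.expectation ?P (\<lambda>f. \<phi> (f k)) = (\<Sum>t\<le>l. y k j t * interval_length \<eta> t)"
        unfolding single[OF k] using s[of k] by (simp add: sum_distrib_left)
    qed
    also have "\<dots> = (\<Sum>t\<le>l. (\<Sum>k\<in>?A. y k j t) * interval_length \<eta> t)"
      by (subst sum.swap) (simp add: sum_distrib_right)
    \<comment> \<open>The column constraints of the program bound the expected load of each interval
      by its length.\<close>
    also have "\<dots> \<le> (\<Sum>t\<le>l. 1 * interval_length \<eta> t)"
    proof (intro sum_mono mult_right_mono)
      fix t assume "t \<in> {..l}"
      then have jt: "j < workers I" "t \<le> top_interval \<eta> I" using q by (auto simp: worker_intervals_def)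
      then have "(\<Sum>k\<in>?A. y k j t) \<le> (\<Sum>k<tasks I. y k j t)"
        using y by (intro sum_mono2) (auto simp: lp_feasible_def)
      also have "\<dots> \<le> 1" using y jt by (auto simp: lp_feasible_def)
      finally show "(\<Sum>k\<in>?A. y k j t) \<le> 1" .
      show "0 \<le> interval_length \<eta> t" using interval_length_pos[OF \<eta>, of t] by simp
    qed
    also have "\<dots> = (1 + \<eta>) ^ l" using sum_interval_length[OF \<eta>, of l] by simp
    finally show ?thesis by (simp add: fun_upd_def)
  qed
  have w: "0 \<le> w j l" if "(j, l) \<in> ?Q" for j l
    using that y s[OF i] interval_length_pos[OF \<eta>, of l] i
    by (auto simp: w_def lp_feasible_def worker_intervals_def intro!: divide_nonneg_pos mult_nonneg_nonneg)
  have w1: "(\<Sum>j<workers I. \<Sum>l\<le>top_interval \<eta> I. w j l) = 1"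
    using y i by (simp add: w_def lp_feasible_def)
  have Ci: "C i = (\<Sum>j<workers I. \<Sum>l\<le>top_interval \<eta> I. w j l * (delay I j + lp_start \<eta> l)) + service I i / 2"
  proof -
    have "C i = (\<Sum>j<workers I. \<Sum>l\<le>top_interval \<eta> I. w j l * (delay I j + lp_start \<eta> l) + w j l * (service I i / 2))"
      using y i s[OF i] by (simp add: lp_feasible_def w_def)
    also have "\<dots> = (\<Sum>j<workers I. \<Sum>l\<le>top_interval \<eta> I. w j l * (delay I j + lp_start \<eta> l)) +
        (\<Sum>j<workers I. \<Sum>l\<le>top_interval \<eta> I. w j l) * (service I i / 2)"
      by (simp only: sum.distrib sum_distrib_right)
    finally show ?thesis by (simp add: w1)
  qed
  have "{..<tasks I} = insert i ?A" using i by auto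
  then have "measure_pmf.expectation (Pi_pmf {..<tasks I} undefined (task_pmf \<eta> I y))
      (\<lambda>z. completion I (induced_schedule \<eta> I z) i) =
      measure_pmf.expectation (Pi_pmf (insert i ?A) undefined (task_pmf \<eta> I y))
      (\<lambda>z. completion I (induced_schedule \<eta> I z) i)" by simp
  also have "\<dots> = (\<Sum>q\<in>?Q. pmf (task_pmf \<eta> I y i) q *
      measure_pmf.expectation ?P (\<lambda>f. completion I (induced_schedule \<eta> I (f(i := q))) i))"
    using fin set_task_pmf_subset[OF I \<eta> y i] by (intro expectation_Pi_pmf_insert) auto
  also have "\<dots> \<le> (\<Sum>(j, l)\<in>?Q. w j l * (service I i + c * (delay I j + lp_start \<eta> l)))"
  proof (rule sum_mono, clarify)
    fix j l assume q: "(j, l) \<in> ?Q"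
    \<comment> \<open>Interval 0 requires the factor 2, as its end is 1 and its
      \<open>lp_start\<close> is \<open>1 / 2\<close>; every later interval requires the factor
      \<open>1 + \<eta>\<close>.\<close>
    have "(1 + \<eta>) ^ l \<le> c * lp_start \<eta> l"
      using \<eta> by (cases l) (auto simp: lp_start_def c_def intro!: mult_right_mono)
    moreover have "delay I j \<le> c * delay I j"
      using I q mult_right_mono[of 1 c "delay I j"]
      by (auto simp: c_def crowd_instance_def worker_intervals_def delay_def)
    ultimately have "delay I j + service I i + (1 + \<eta>) ^ l \<le> service I i + c * (delay I j + lp_start \<eta> l)"
      by (simp add: distrib_left)
    then have "measure_pmf.expectation ?P (\<lambda>f. completion I (induced_schedule \<eta> I (f(i := (j, l)))) i) \<le>
        service I i + c * (delay I j + lp_start \<eta> l)"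
      using rest[OF q] by linarith
    then show "pmf (task_pmf \<eta> I y i) (j, l) *
        measure_pmf.expectation ?P (\<lambda>f. completion I (induced_schedule \<eta> I (f(i := (j, l)))) i) \<le>
        w j l * (service I i + c * (delay I j + lp_start \<eta> l))"
      unfolding pmf_task_pmf[OF I \<eta> y i q] w_def[symmetric] using w[OF q] by (rule mult_left_mono)
  qed
  also have "\<dots> = (\<Sum>j<workers I. \<Sum>l\<le>top_interval \<eta> I. w j l * service I i + w j l * (delay I j + lp_start \<eta> l) * c)"
    unfolding sum_worker_intervals by (simp add: algebra_simps)
  also have "\<dots> = service I i + c * (\<Sum>j<workers I. \<Sum>l\<le>top_interval \<eta> I. w j l * (delay I j + lp_start \<eta> l))"
    by (simp only: sum.distrib flip: sum_distrib_right) (simp add: w1)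
  \<comment> \<open>The service time of \<open>i\<close> is counted in full here but only by half in
    \<open>C i\<close>, which again uses \<open>2 \<le> c\<close>.\<close>
  also have "\<dots> \<le> c * C i"
    using mult_right_mono[of 2 c "service I i / 2"] s[OF i] unfolding Ci distrib_left
    by (simp add: c_def)
  finally show ?thesis by (simp add: c_def)
qed

lemma expected_cost_le:
  assumes I: "crowd_instance I" and \<eta>: "0 < \<eta>" and y: "lp_feasible \<eta> I y C"
  shows "cond_exp_cost \<eta> I y {} x \<le> max 2 (1 + \<eta>) * lp_objective I C"
proof -
  let ?P = "Pi_pmf {..<tasks I} undefined (task_pmf \<eta> I y)"
  have int: "integrable ?P f" for f :: "_ \<Rightarrow> real"
    by (intro integrable_measure_pmf_finite finite_set_Pi_pmf finite_subset[OF set_task_pmf_subset[OF I \<eta> y]]) auto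
  have "cond_exp_cost \<eta> I y {} x = measure_pmf.expectation ?P (\<lambda>z. total_cost I (induced_schedule \<eta> I z))"
    by (simp add: cond_exp_cost_def)
  also have "\<dots> = (\<Sum>i<tasks I. weight I i *
      measure_pmf.expectation ?P (\<lambda>z. completion I (induced_schedule \<eta> I z) i))"
    unfolding total_cost_def using int by (simp add: Bochner_Integration.integral_sum)
  also have "\<dots> \<le> (\<Sum>i<tasks I. weight I i * (max 2 (1 + \<eta>) * C i))"
    using I expected_completion_le[OF I \<eta> y]
    by (intro sum_mono mult_left_mono) (auto simp: crowd_instance_def less_imp_le)
  also have "\<dots> = max 2 (1 + \<eta>) * lp_objective I C"
    by (simp add: lp_objective_def sum_distrib_left mult.left_commute)
  finally show ?thesis .
qed

section \<open>Derandomization by conditional expectations\<close>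

lemma cond_exp_cost_split:
  assumes I: "crowd_instance I" and \<eta>: "0 < \<eta>" and y: "lp_feasible \<eta> I y C"
    and i: "i < tasks I" "i \<notin> P"
  shows "cond_exp_cost \<eta> I y P x =
    (\<Sum>q\<in>worker_intervals \<eta> I. pmf (task_pmf \<eta> I y i) q * cond_exp_cost \<eta> I y (insert i P) (x(i := q)))"
proof -
  let ?A = "{..<tasks I} - {i}"
  define p where "p = (\<lambda>k. if k \<in> P then return_pmf (x k) else task_pmf \<eta> I y k)"
  define p' where "p' q = (\<lambda>k. if k \<in> insert i P then return_pmf ((x(i := q)) k) else task_pmf \<eta> I y k)" for q
  have N: "{..<tasks I} = insert i ?A" using i by auto
  have fin: "finite (set_pmf (task_pmf \<eta> I y k))" if "k < tasks I" for k
    using set_task_pmf_subset[OF I \<eta> y that] by (rule finite_subset) simp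
  define E where "E q = measure_pmf.expectation (Pi_pmf ?A undefined p)
      (\<lambda>f. total_cost I (induced_schedule \<eta> I (f(i := q))))" for q
  have "cond_exp_cost \<eta> I y (insert i P) (x(i := q)) = E q" for q
  proof -
    \<comment> \<open>By independence, fixing task \<open>i\<close> does not alter the joint
      distribution of the other tasks.\<close>
    have "Pi_pmf ?A undefined (p' q) = Pi_pmf ?A undefined p"
      by (intro Pi_pmf_cong) (auto simp: p_def p'_def)
    then show ?thesis
      unfolding cond_exp_cost_def p'_def[symmetric] E_def using fin
      by (subst N, subst expectation_Pi_pmf_insert[where Q = "{q}"]) (auto simp: p'_def)
  qed
  moreover have "cond_exp_cost \<eta> I y P x = (\<Sum>q\<in>worker_intervals \<eta> I. pmf (task_pmf \<eta> I y i) q * E q)"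
    unfolding cond_exp_cost_def p_def[symmetric] E_def using fin i set_task_pmf_subset[OF I \<eta> y i(1)]
    by (subst N, subst expectation_Pi_pmf_insert[where Q = "worker_intervals \<eta> I"]) (auto simp: p_def)
  ultimately show ?thesis by simp
qed

text \<open>Before each step the conditional expectation is a weighted average over the possible
  pairs, so a best pair cannot exceed it. That the chosen pairs are legitimate is carried along for
  the validity of the final schedule.\<close>

lemma dis_fix_invariant:
  assumes I: "crowd_instance I" and \<eta>: "0 < \<eta>" and y: "lp_feasible \<eta> I y C"
    and tie: "\<forall>i A. A \<noteq> {} \<longrightarrow> tie i A \<in> A" and n: "n \<le> tasks I"
  shows "(\<forall>k<n. dis_fix \<eta> I y tie n k \<in> worker_intervals \<eta> I) \<and>
    cond_exp_cost \<eta> I y {..<n} (dis_fix \<eta> I y tie n) \<le> cond_exp_cost \<eta> I y {} (\<lambda>_. undefined)"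
  using n
proof (induction n)
  case (Suc i)
  let ?Q = "worker_intervals \<eta> I"
  let ?x = "dis_fix \<eta> I y tie i"
  define E where "E p = cond_exp_cost \<eta> I y (insert i {..<i}) (?x(i := p))" for p
  define M where "M = {p \<in> ?Q. \<forall>q\<in>?Q. E p \<le> E q}"
  \<comment> \<open>Some pair exists, so the set of minimizers handed to \<open>tie\<close> is
    nonempty and \<open>tie\<close> must return one of them.\<close>
  have "(0, 0) \<in> ?Q" using I by (simp add: worker_intervals_def crowd_instance_def)
  then have "Min (E ` ?Q) \<in> E ` ?Q" by (intro Min_in) auto
  then obtain p where "p \<in> ?Q" "E p = Min (E ` ?Q)" by auto
  then have "p \<in> M" by (simp add: M_def)
  then have best: "tie i M \<in> M" using tie by blast
  have x: "dis_fix \<eta> I y tie (Suc i) = ?x(i := tie i M)"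
    by (simp add: Let_def M_def E_def)
  have i: "i < tasks I" using Suc.prems by simp
  have "(\<Sum>q\<in>?Q. pmf (task_pmf \<eta> I y i) q) = 1"
    using set_task_pmf_subset[OF I \<eta> y i] by (intro sum_pmf_eq_1) auto
  then have "E (tie i M) = (\<Sum>q\<in>?Q. pmf (task_pmf \<eta> I y i) q * E (tie i M))"
    by (simp flip: sum_distrib_right)
  also have "\<dots> \<le> (\<Sum>q\<in>?Q. pmf (task_pmf \<eta> I y i) q * E q)"
    using best by (intro sum_mono mult_left_mono) (auto simp: M_def)
  also have "\<dots> = cond_exp_cost \<eta> I y {..<i} ?x"
    unfolding E_def by (rule cond_exp_cost_split[OF I \<eta> y i, symmetric]) simp
  finally have "cond_exp_cost \<eta> I y {..<Suc i} (dis_fix \<eta> I y tie (Suc i)) \<le> cond_exp_cost \<eta> I y {..<i} ?x"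
    by (simp only: x E_def lessThan_Suc)
  also have "\<dots> \<le> cond_exp_cost \<eta> I y {} (\<lambda>_. undefined)" using Suc by simp
  finally have "cond_exp_cost \<eta> I y {..<Suc i} (dis_fix \<eta> I y tie (Suc i)) \<le> \<dots>" .
  moreover have "\<forall>k<Suc i. dis_fix \<eta> I y tie (Suc i) k \<in> ?Q"
    using Suc best unfolding x by (auto simp: M_def less_Suc_eq)
  ultimately show ?case by blast
qed simp

lemma induced_schedule_cong:
  assumes "\<And>i. i < tasks I \<Longrightarrow> x i = z i"
  shows "induced_schedule \<eta> I x = induced_schedule \<eta> I z"
  using assms by (auto simp: induced_schedule_def restrict_def)

text \<open>A product of point masses is a point mass. It agrees with \<open>x\<close> on the tasks,
  and the induced schedule ignores all other arguments.\<close>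

lemma cond_exp_cost_all:
  "cond_exp_cost \<eta> I y {..<tasks I} x = total_cost I (induced_schedule \<eta> I x)"
proof -
  let ?z = "\<lambda>k. if k \<in> {..<tasks I} then x k else undefined"
  have "Pi_pmf {..<tasks I} undefined (\<lambda>i. if i \<in> {..<tasks I} then return_pmf (x i) else task_pmf \<eta> I y i) =
      Pi_pmf {..<tasks I} undefined (\<lambda>i. return_pmf (x i))"
    by (intro Pi_pmf_cong) auto
  also have "\<dots> = return_pmf ?z" by (simp add: lessThan_iff[symmetric] del: lessThan_iff)
  finally have "cond_exp_cost \<eta> I y {..<tasks I} x = total_cost I (induced_schedule \<eta> I ?z)"
    by (simp add: cond_exp_cost_def)
  also have "induced_schedule \<eta> I ?z = induced_schedule \<eta> I x"
    by (intro induced_schedule_cong) simp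
  finally show ?thesis .
qed

text \<open>Comparing first by left endpoint and then by index is a lexicographic order, hence
  linear.\<close>

lemma induced_schedule_in_schedules:
  assumes "\<And>i. i < tasks I \<Longrightarrow> x i \<in> worker_intervals \<eta> I"
  shows "induced_schedule \<eta> I x \<in> schedules I"
proof -
  define key where "key i = left_endpoint \<eta> (snd (x i))" for i
  have "linear_order_on {..<tasks I}
      {(k, i). k < tasks I \<and> i < tasks I \<and> (key k < key i \<or> key k = key i \<and> k \<le> i)}"
    unfolding order_on_defs refl_on_def trans_def antisym_def total_on_def by auto
  moreover have "restrict (\<lambda>i. fst (x i)) {..<tasks I} \<in> {..<tasks I} \<rightarrow>\<^sub>E {..<workers I}"
    using assms by (intro restrict_PiE_iff[THEN iffD2]) (auto simp: worker_intervals_def mem_Times_iff)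
  ultimately show ?thesis by (simp add: schedules_def induced_schedule_def key_def)
qed

theorem theorem7:
  fixes I :: crowd and \<epsilon> :: real and y :: lp_vars and C :: "nat \<Rightarrow> real"
    and tie :: "nat \<Rightarrow> (nat \<times> nat) set \<Rightarrow> nat \<times> nat"
  assumes "crowd_instance I"
    and "\<forall>i<tasks I. 1 \<le> service I i"
    and "0 < \<epsilon>"
    and "lp_optimal \<epsilon> I y C"
    and "\<forall>i A. A \<noteq> {} \<longrightarrow> tie i A \<in> A"
  shows "dis_schedule \<epsilon> I y tie \<in> schedules I \<and>
         total_cost I (dis_schedule \<epsilon> I y tie) \<le> max (5 / 2) (1 + \<epsilon>) * min_cost I"
proof
  have feas: "lp_feasible \<epsilon> I y C" using assms(4) by (simp add: lp_optimal_def)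
  note inv = dis_fix_invariant[OF assms(1,3) feas assms(5) order_refl]
  show "dis_schedule \<epsilon> I y tie \<in> schedules I"
    unfolding dis_schedule_def using inv by (intro induced_schedule_in_schedules) blast
  have "min_cost I \<in> total_cost I ` schedules I"
    unfolding min_cost_def using finite_schedules schedules_nonempty[OF assms(1)] by (intro Min_in) auto
  then have "lp_objective I C \<le> min_cost I"
    using lp_objective_le_total_cost[OF assms(1-4)] by auto
  \<comment> \<open>Nonnegativity is what allows both factors of the product to be enlarged in the
    last step.\<close>
  moreover have "0 \<le> lp_objective I C"
    unfolding lp_objective_def
  proof (intro sum_nonneg mult_nonneg_nonneg)
    fix i assume "i \<in> {..<tasks I}"
    then have "service I i \<le> C i" "0 < service I i" "0 < weight I i"
      using feas assms(1) unfolding lp_feasible_iff[OF assms(1,3)] by (auto simp: crowd_instance_def)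
    then show "0 \<le> weight I i" "0 \<le> C i" by auto
  qed
  \<comment> \<open>The factor reached is \<open>max 2 (1 + \<epsilon>)\<close>; it is weakened to
    the stated constant only at the end.\<close>
  moreover have "total_cost I (dis_schedule \<epsilon> I y tie) \<le> max 2 (1 + \<epsilon>) * lp_objective I C"
    unfolding dis_schedule_def cond_exp_cost_all[symmetric, where y = y]
    using inv expected_cost_le[OF assms(1,3) feas] order_trans by blast
  ultimately show "total_cost I (dis_schedule \<epsilon> I y tie) \<le> max (5 / 2) (1 + \<epsilon>) * min_cost I"
    by (elim order_trans) (intro mult_mono, auto)
qed

end
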